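(* Let $K\in\mathbb{N}$ and suppose that under $M_K$ the parameters $\lambda_1,\ldots,\lambda_K$ are a priori independent and each $\lambda_i$ follows a univariate normal distribution with mean $m_i^{(K)}\in\mathbb{R}$ and variance $v_i^{(K)}>0$, i.e. $\pi_{\underline{\lambda_i}}(\lambda_i|M_K)=f_N(\lambda_i|m_i^{(K)},v_i^{(K)})$. Then the coherent prior for $\lambda_1$ under $M_1$ is the normal distribution with mean $m^{(1)}$ and variance $v^{(1)}$, $\pi_{\underline{\lambda_1}}(\lambda_1|M_1)=f_N(\lambda_1|m^{(1)},v^{(1)})$, where $$m^{(1)}=\frac{\sum_{i=1}^{K}\frac{m_i^{(K)}}{v_i^{(K)}}}{\sum_{i=1}^{K}\frac{1}{v_i^{(K)}}},\qquad v^{(1)}=\left(\sum_{i=1}^{K}\frac{1}{v_i^{(K)}}\right)^{-1}.$$ Alternatively, in terms of precisions $\breve v_i^{(K)}=(v_i^{(K)})^{-1}$: if $\pi_{\underline{\lambda_i}}(\lambda_i|M_K)=f_N(\lambda_i|m_i^{(K)},(\breve v_i^{(K)})^{-1})$ for each $i=1,\ldots,K$, then $\pi_{\underline{\lambda_1}}(\lambda_1|M_1)=f_N(\lambda_1|m^{(1)},(\breve v^{(1)})^{-1})$, where $$m^{(1)}=\frac{\sum_{i=1}^{K}\breve v_i^{(K)}m_i^{(K)}}{\sum_{i=1}^{K}\breve v_i^{(K)}},\qquad \breve v^{(1)}=\sum_{i=1}^{K}\breve v_i^{(K)}.$$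
   Context: $f_N(\cdot|m,v)$ is the density of the normal distribution with mean $m$ and variance $v$. $M_K$ is a $K$-component (mixture or Markov-switching) model containing a group of scalar mixture parameters $\lambda_1,\ldots,\lambda_K$, a priori independent of each other (and of all other parameters) with densities $\pi_{\underline{\lambda_i}}(\cdot|M_K)$. $M_1$ is the nested single-component model, with a single scalar parameter $\lambda_1$ in place of this group, obtained from $M_K$ under $\lambda_1=\ldots=\lambda_K$. Let $\tau_i=\lambda_i-\lambda_1$ ($i=2,\ldots,K$), $\tau=(\tau_2,\ldots,\tau_K)'$ (empty if $K=1$), and let $p(x,t)=p_\lambda(x,t_2+x,\ldots,t_K+x)$ be the joint prior density of $(\lambda_1,\tau)$ under $M_K$, with $p_\lambda$ the joint density of $(\lambda_1,\ldots,\lambda_K)$, evaluated pointwise. The coherent prior for $\lambda_1$ under $M_1$ is the conditional prior of $\lambda_1$ given $\tau=0$ under $M_K$, i.e. the distribution with density $x\mapsto p(x,0)/\int_{\mathbb{R}}p(u,0)\,du$. *)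

theory Defs
  imports "HOL-Probability.Probability"
begin

text \<open>The second parameter of the library's \<^const>\<open>normal_density\<close> is the standard deviation.\<close>

definition f_N :: "real \<Rightarrow> real \<Rightarrow> real \<Rightarrow> real" where
  "f_N x m v = normal_density m (sqrt v) x"

text \<open>
  \<open>\<Lambda> i\<close>, for \<open>i \<in> {1..K}\<close>, is the random variable on the prior probability space \<open>M\<close> that
  represents the parameter \<open>\<lambda>\<^sub>i\<close>; its prior density \<open>\<pi> i\<close> is a fixed function, not a class of
  almost everywhere equal ones.
\<close>

definition independent_priors ::
  "'w measure \<Rightarrow> nat \<Rightarrow> (nat \<Rightarrow> 'w \<Rightarrow> real) \<Rightarrow> (nat \<Rightarrow> real \<Rightarrow> real) \<Rightarrow> bool" where
  "independent_priors M K \<Lambda> \<pi> \<longleftrightarrow>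
     prob_space M \<and>
     prob_space.indep_vars M (\<lambda>_. borel) \<Lambda> {1..K} \<and>
     (\<forall>i\<in>{1..K}. (\<forall>x. 0 \<le> \<pi> i x) \<and> distributed M lborel (\<Lambda> i) (\<lambda>x. ennreal (\<pi> i x)))"

text \<open>
  The joint density of \<open>(\<lambda>\<^sub>1, \<dots>, \<lambda>\<^sub>K)\<close>. Conditioning on \<open>\<tau> = 0\<close> evaluates it on a null set, so the
  version matters: it is the pointwise product of the given marginal densities. That this product
  is a density of the joint law is lemma \<open>joint_prior_density_distributed\<close>.
\<close>

definition joint_prior_density :: "nat \<Rightarrow> (nat \<Rightarrow> real \<Rightarrow> real) \<Rightarrow> (nat \<Rightarrow> real) \<Rightarrow> real" where
  "joint_prior_density K \<pi> l = (\<Prod>i=1..K. \<pi> i (l i))"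

lemma joint_prior_density_distributed:
  assumes "K \<ge> 1" and "independent_priors M K \<Lambda> \<pi>"
  shows "distributed M (\<Pi>\<^sub>M i\<in>{1..K}. lborel) (\<lambda>\<omega>. \<lambda>i\<in>{1..K}. \<Lambda> i \<omega>)
           (\<lambda>l. ennreal (joint_prior_density K \<pi> l))"
proof -
  interpret prob_space M using assms(2) by (simp add: independent_priors_def)
  let ?I = "{1..K}"
  define N where "N i = (if i \<in> ?I then density lborel (\<lambda>x. ennreal (\<pi> i x)) else return lborel 0)" for i
  have ind: "indep_vars (\<lambda>_. borel) \<Lambda> ?I"
    and nn: "\<And>i x. i \<in> ?I \<Longrightarrow> 0 \<le> \<pi> i x"
    and d: "\<And>i. i \<in> ?I \<Longrightarrow> distributed M lborel (\<Lambda> i) (\<lambda>x. ennreal (\<pi> i x))"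
    using assms(2) by (auto simp: independent_priors_def)
  have rv: "\<And>i. i \<in> ?I \<Longrightarrow> \<Lambda> i \<in> measurable M lborel"
    and dm[measurable]: "\<And>i. i \<in> ?I \<Longrightarrow> (\<lambda>x. ennreal (\<pi> i x)) \<in> borel_measurable lborel"
    and deq: "\<And>i. i \<in> ?I \<Longrightarrow> distr M lborel (\<Lambda> i) = density lborel (\<lambda>x. ennreal (\<pi> i x))"
    using d by (auto simp: distributed_def)
  have ind': "indep_vars (\<lambda>_. lborel) \<Lambda> ?I"
    using ind by (simp add: indep_vars_def)
  have joint: "distr M (\<Pi>\<^sub>M i\<in>?I. lborel) (\<lambda>\<omega>. \<lambda>i\<in>?I. \<Lambda> i \<omega>) = (\<Pi>\<^sub>M i\<in>?I. distr M lborel (\<Lambda> i))"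
    using indep_vars_iff_distr_eq_PiM'[of ?I \<Lambda> "\<lambda>_. lborel"] ind' rv assms(1) by auto
  also have "\<dots> = PiM ?I N"
    by (intro PiM_cong) (auto simp: N_def deq)
  finally have joint_N:
    "distr M (\<Pi>\<^sub>M i\<in>?I. lborel) (\<lambda>\<omega>. \<lambda>i\<in>?I. \<Lambda> i \<omega>) = PiM ?I N" .
  have psN: "prob_space (N i)" for i
  proof (cases "i \<in> ?I")
    case True
    then have "N i = distr M lborel (\<Lambda> i)" by (simp add: N_def deq)
    then show ?thesis using prob_space_distr[OF rv[OF True]] by simp
  next
    case False
    then have "N i = return lborel 0" unfolding N_def by (rule if_not_P)
    then show ?thesis by (simp add: prob_space_return)
  qed
  interpret PN: product_prob_space N
    by (intro product_prob_spaceI psN)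
  interpret PL: product_sigma_finite "\<lambda>_::nat. lborel :: real measure"
    by standard
  have meas[measurable]:
    "(\<lambda>l. \<Prod>i=1..K. ennreal (\<pi> i (l i))) \<in> borel_measurable (\<Pi>\<^sub>M i\<in>?I. lborel)"
  proof (rule borel_measurable_prod_ennreal)
    fix i assume i: "i \<in> ?I"
    have "(\<lambda>l. l i) \<in> measurable (\<Pi>\<^sub>M i\<in>?I. lborel) lborel"
      using measurable_component_singleton[OF i, of "\<lambda>_. lborel"] .
    from measurable_compose[OF this dm[OF i]]
    show "(\<lambda>l. ennreal (\<pi> i (l i))) \<in> borel_measurable (\<Pi>\<^sub>M i\<in>?I. lborel)" .
  qed
  have eq: "ennreal (joint_prior_density K \<pi> l) = (\<Prod>i=1..K. ennreal (\<pi> i (l i)))" for l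
    unfolding joint_prior_density_def by (rule prod_ennreal[symmetric]) (rule nn)
  have setsN: "sets (N i) = sets lborel" for i
    by (simp add: N_def)
  have "density (\<Pi>\<^sub>M i\<in>?I. lborel) (\<lambda>l. \<Prod>i=1..K. ennreal (\<pi> i (l i))) = PiM ?I N"
  proof (rule PN.PiM_eqI)
    show "finite ?I" by simp
    show "sets (density (\<Pi>\<^sub>M i\<in>?I. lborel) (\<lambda>l. \<Prod>i=1..K. ennreal (\<pi> i (l i)))) = sets (PiM ?I N)"
      by (simp, intro sets_PiM_cong) (simp_all add: setsN)
    fix A assume A: "\<And>i. i \<in> ?I \<Longrightarrow> A i \<in> sets (N i)"
    then have Ab: "\<And>i. i \<in> ?I \<Longrightarrow> A i \<in> sets lborel" by (simp add: setsN)
    have PA: "Pi\<^sub>E ?I A \<in> sets (\<Pi>\<^sub>M i\<in>?I. lborel)"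
      using Ab by (intro sets_PiM_I_finite) auto
    have ind_eq: "indicator (Pi\<^sub>E ?I A) l = (\<Prod>i=1..K. indicator (A i) (l i) :: ennreal)"
      if l: "l \<in> space (\<Pi>\<^sub>M i\<in>?I. (lborel :: real measure))" for l
    proof (cases "l \<in> Pi\<^sub>E ?I A")
      case True
      then show ?thesis by (auto simp: PiE_iff)
    next
      case False
      then obtain i where "i \<in> ?I" "l i \<notin> A i"
        using l by (auto simp: space_PiM PiE_iff)
      then have "(\<Prod>i=1..K. indicator (A i) (l i) :: ennreal) = 0"
        by (intro prod_zero) (auto intro!: bexI[of _ i])
      then show ?thesis using False by simp
    qed
    have "emeasure (density (\<Pi>\<^sub>M i\<in>?I. lborel) (\<lambda>l. \<Prod>i=1..K. ennreal (\<pi> i (l i)))) (Pi\<^sub>E ?I A)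
        = (\<integral>\<^sup>+l. (\<Prod>i=1..K. ennreal (\<pi> i (l i))) * indicator (Pi\<^sub>E ?I A) l \<partial>(\<Pi>\<^sub>M i\<in>?I. lborel))"
      using PA by (simp add: emeasure_density)
    also have "\<dots> = (\<integral>\<^sup>+l. (\<Prod>i=1..K. ennreal (\<pi> i (l i)) * indicator (A i) (l i)) \<partial>(\<Pi>\<^sub>M i\<in>?I. lborel))"
      by (intro nn_integral_cong) (simp only: ind_eq prod.distrib)
    also have "\<dots> = (\<Prod>i=1..K. \<integral>\<^sup>+x. ennreal (\<pi> i x) * indicator (A i) x \<partial>lborel)"
    proof (rule PL.product_nn_integral_prod)
      fix i assume i: "i \<in> ?I"
      show "(\<lambda>x. ennreal (\<pi> i x) * indicator (A i) x) \<in> borel_measurable lborel"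
        using dm[OF i] Ab[OF i] by (intro borel_measurable_times_ennreal borel_measurable_indicator)
    qed simp
    also have "\<dots> = (\<Prod>i=1..K. emeasure (N i) (A i))"
      by (intro prod.cong) (use Ab dm in \<open>auto simp: N_def emeasure_density\<close>)
    finally show "emeasure (density (\<Pi>\<^sub>M i\<in>?I. lborel) (\<lambda>l. \<Prod>i=1..K. ennreal (\<pi> i (l i)))) (Pi\<^sub>E ?I A)
        = (\<Prod>i=1..K. emeasure (N i) (A i))" .
  qed
  moreover have "(\<lambda>\<omega>. \<lambda>i\<in>?I. \<Lambda> i \<omega>) \<in> measurable M (\<Pi>\<^sub>M i\<in>?I. lborel)"
    using rv by (intro measurable_restrict) auto
  ultimately show ?thesis
    unfolding distributed_def eq using joint_N meas by simp
qed

text \<open>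
  For a joint density \<open>pl\<close> of \<open>(\<lambda>\<^sub>1, \<dots>, \<lambda>\<^sub>K)\<close>: the joint density of \<open>(\<lambda>\<^sub>1, \<tau>)\<close> with
  \<open>\<tau>\<^sub>i = \<lambda>\<^sub>i - \<lambda>\<^sub>1\<close>. Only \<open>t i\<close> for \<open>2 \<le> i \<le> K\<close> is used.
\<close>

definition reparam_density ::
  "nat \<Rightarrow> ((nat \<Rightarrow> real) \<Rightarrow> real) \<Rightarrow> real \<Rightarrow> (nat \<Rightarrow> real) \<Rightarrow> real" where
  "reparam_density K pl x t = pl (\<lambda>i\<in>{1..K}. if i = 1 then x else t i + x)"

definition coherent_prior_density ::
  "nat \<Rightarrow> ((nat \<Rightarrow> real) \<Rightarrow> real) \<Rightarrow> real \<Rightarrow> real" where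
  "coherent_prior_density K pl x =
     reparam_density K pl x (\<lambda>_. 0) / (LINT u|lborel. reparam_density K pl u (\<lambda>_. 0))"

definition coherent_prior :: "nat \<Rightarrow> ((nat \<Rightarrow> real) \<Rightarrow> real) \<Rightarrow> real measure" where
  "coherent_prior K pl = density lborel (\<lambda>x. ennreal (coherent_prior_density K pl x))"

end

theory Submission
  imports Defs
begin

text \<open>
  Setting \<open>\<tau> = 0\<close> restricts the joint prior density to the diagonal
  \<open>\<lambda>\<^sub>1 = \<dots> = \<lambda>\<^sub>K = x\<close>. There it is the product of the marginal densities at the common point
  \<open>x\<close>, so the coherent prior is the normalised product of \<open>K\<close> normal densities.

  With precisions \<open>w i\<close>, this product is a constant times
  \<open>exp (- (\<Sum>i. w i * (x - m i)\<^sup>2) / 2)\<close>. The exponent is a quadratic in \<open>x\<close>; completing the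
  square (\<open>weighted_sum_squares\<close>) turns it into \<open>- W * (x - \<mu>)\<^sup>2 / 2\<close> plus a term free of \<open>x\<close>,
  where \<open>W\<close> is the total precision and \<open>\<mu>\<close> the precision-weighted mean. Hence the product is
  proportional to the normal density with mean \<open>\<mu>\<close> and precision \<open>W\<close>
  (\<open>prod_f_N_proportional\<close>). Dividing by the integral removes the constant of proportionality,
  because a normal density integrates to 1. The parametrisation by variances is the case
  \<open>w i = inverse (v i)\<close>.
\<close>

lemma f_N_precision:
  assumes "w > 0"
  shows "f_N x m (inverse w) = sqrt (w / (2 * pi)) * exp (- (w * (x - m)\<^sup>2) / 2)"
  using assms
  by (simp add: f_N_def normal_density_def real_sqrt_divide real_sqrt_mult field_simps)

text \<open>
  The parallel axis identity: a weighted sum of squared distances to \<open>x\<close> splits at the weighted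
  mean, since the deviations from that mean have weighted sum zero.
\<close>

lemma weighted_sum_squares:
  fixes w m :: "'i \<Rightarrow> real" and x :: real
  assumes "(\<Sum>i\<in>I. w i) \<noteq> 0"
  defines "\<mu> \<equiv> (\<Sum>i\<in>I. w i * m i) / (\<Sum>i\<in>I. w i)"
  shows "(\<Sum>i\<in>I. w i * (x - m i)\<^sup>2)
    = (\<Sum>i\<in>I. w i) * (x - \<mu>)\<^sup>2 + (\<Sum>i\<in>I. w i * (\<mu> - m i)\<^sup>2)"
proof -
  have mean: "(\<Sum>i\<in>I. w i * m i) = \<mu> * (\<Sum>i\<in>I. w i)"
    using assms(1) by (simp add: \<mu>_def)
  have dev: "(\<Sum>i\<in>I. w i * (\<mu> - m i)) = 0"
    by (simp add: right_diff_distrib sum_subtractf mean flip: sum_distrib_right)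
  have "(\<Sum>i\<in>I. w i * (x - m i)\<^sup>2)
      = (\<Sum>i\<in>I. w i * (x - \<mu>)\<^sup>2 + 2 * (x - \<mu>) * (w i * (\<mu> - m i)) + w i * (\<mu> - m i)\<^sup>2)"
    by (intro sum.cong refl) (simp add: power2_eq_square algebra_simps)
  also have "\<dots> = (\<Sum>i\<in>I. w i) * (x - \<mu>)\<^sup>2 + 2 * (x - \<mu>) * (\<Sum>i\<in>I. w i * (\<mu> - m i))
      + (\<Sum>i\<in>I. w i * (\<mu> - m i)\<^sup>2)"
    by (simp add: sum.distrib sum_distrib_left sum_distrib_right)
  finally show ?thesis
    by (simp add: dev)
qed

text \<open>
  The constant absorbs both the normalising factors and the part of the exponent left over by
  completing the square. Its sign is part of the claim because a zero constant would not
  cancel on dividing by the integral.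
\<close>

lemma prod_f_N_proportional:
  fixes w m :: "'i \<Rightarrow> real"
  assumes "finite I" "I \<noteq> {}" and pos: "\<And>i. i \<in> I \<Longrightarrow> w i > 0"
  shows "\<exists>c>0. \<forall>x. (\<Prod>i\<in>I. f_N x (m i) (inverse (w i)))
    = c * f_N x ((\<Sum>i\<in>I. w i * m i) / (\<Sum>i\<in>I. w i)) (inverse (\<Sum>i\<in>I. w i))"
proof -
  define W where "W = (\<Sum>i\<in>I. w i)"
  define \<mu> where "\<mu> = (\<Sum>i\<in>I. w i * m i) / W"
  define A where "A = (\<Prod>i\<in>I. sqrt (w i / (2 * pi)))"
  define S where "S = (\<Sum>i\<in>I. w i * (\<mu> - m i)\<^sup>2)"
  have W: "W > 0"
    unfolding W_def using assms by (intro sum_pos) auto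
  have A: "A > 0"
    unfolding A_def using pos by (intro prod_pos) simp
  have "(\<Prod>i\<in>I. f_N x (m i) (inverse (w i)))
      = A * exp (- S / 2) / sqrt (W / (2 * pi)) * f_N x \<mu> (inverse W)" for x
  proof -
    have split: "(\<Sum>i\<in>I. w i * (x - m i)\<^sup>2) = W * (x - \<mu>)\<^sup>2 + S"
      using weighted_sum_squares[of w I x m] W by (simp add: W_def \<mu>_def S_def)
    have "(\<Prod>i\<in>I. f_N x (m i) (inverse (w i)))
        = A * (\<Prod>i\<in>I. exp (- (w i * (x - m i)\<^sup>2) / 2))"
      using pos by (simp add: f_N_precision A_def prod.distrib)
    also have "\<dots> = A * exp (- (\<Sum>i\<in>I. w i * (x - m i)\<^sup>2) / 2)"
      using assms(1) by (simp add: exp_sum[symmetric] sum_negf sum_divide_distrib)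
    also have "\<dots> = A * exp (- S / 2) * exp (- (W * (x - \<mu>)\<^sup>2) / 2)"
      by (simp add: split mult_exp_exp algebra_simps add_divide_distrib diff_divide_distrib)
    finally show ?thesis
      using W by (simp add: f_N_precision)
  qed
  moreover have "A * exp (- S / 2) / sqrt (W / (2 * pi)) > 0"
    using A W by simp
  ultimately show ?thesis
    unfolding W_def \<mu>_def by blast
qed

lemma reparam_joint_prior_density_diagonal:
  "reparam_density K (joint_prior_density K \<pi>) x (\<lambda>_. 0) = (\<Prod>i=1..K. \<pi> i x)"
  unfolding reparam_density_def joint_prior_density_def by (intro prod.cong) auto

lemma coherent_prior_density_eqI:
  assumes "c \<noteq> 0" and "\<And>x. reparam_density K pl x (\<lambda>_. 0) = c * g x"
    and "(LINT u|lborel. g u) = 1"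
  shows "coherent_prior_density K pl = g"
  using assms by (simp add: coherent_prior_density_def fun_eq_iff)

lemma coherent_prior_density_normal_precision:
  fixes m w :: "nat \<Rightarrow> real"
  assumes "K \<ge> 1" and pos: "\<And>i. i \<in> {1..K} \<Longrightarrow> w i > 0"
  shows "coherent_prior_density K (joint_prior_density K (\<lambda>i x. f_N x (m i) (inverse (w i))))
    = (\<lambda>x. f_N x ((\<Sum>i=1..K. w i * m i) / (\<Sum>i=1..K. w i)) (inverse (\<Sum>i=1..K. w i)))"
proof -
  have W: "(\<Sum>i=1..K. w i) > 0"
    using assms by (intro sum_pos) auto
  obtain c where "c > 0" and c: "\<And>x. (\<Prod>i=1..K. f_N x (m i) (inverse (w i)))
      = c * f_N x ((\<Sum>i=1..K. w i * m i) / (\<Sum>i=1..K. w i)) (inverse (\<Sum>i=1..K. w i))"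
    using prod_f_N_proportional[of "{1..K}" w m] assms by auto
  show ?thesis
  proof (rule coherent_prior_density_eqI)
    show "c \<noteq> 0"
      using \<open>c > 0\<close> by simp
    show "(LINT u|lborel. f_N u ((\<Sum>i=1..K. w i * m i) / (\<Sum>i=1..K. w i))
        (inverse (\<Sum>i=1..K. w i))) = 1"
      unfolding f_N_def by (rule integral_normal_density) (use W in simp)
  qed (simp only: reparam_joint_prior_density_diagonal c)
qed

theorem proposition1:
  fixes M :: "'w measure" and K :: nat and \<Lambda> :: "nat \<Rightarrow> 'w \<Rightarrow> real"
    and m v w :: "nat \<Rightarrow> real"
  assumes "K \<ge> 1"
  shows
    "((\<forall>i\<in>{1..K}. v i > 0) \<and> independent_priors M K \<Lambda> (\<lambda>i x. f_N x (m i) (v i)) \<longrightarrow>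
        (let pl = joint_prior_density K (\<lambda>i x. f_N x (m i) (v i));
             m1 = (\<Sum>i=1..K. m i / v i) / (\<Sum>i=1..K. 1 / v i);
             v1 = inverse (\<Sum>i=1..K. 1 / v i)
         in v1 > 0 \<and>
            coherent_prior K pl = density lborel (\<lambda>x. ennreal (f_N x m1 v1)) \<and>
            (\<forall>x. coherent_prior_density K pl x = f_N x m1 v1)))
     \<and>
     ((\<forall>i\<in>{1..K}. w i > 0) \<and> independent_priors M K \<Lambda> (\<lambda>i x. f_N x (m i) (inverse (w i))) \<longrightarrow>
        (let pl = joint_prior_density K (\<lambda>i x. f_N x (m i) (inverse (w i)));
             m1 = (\<Sum>i=1..K. w i * m i) / (\<Sum>i=1..K. w i);
             w1 = (\<Sum>i=1..K. w i)
         in w1 > 0 \<and>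
            coherent_prior K pl = density lborel (\<lambda>x. ennreal (f_N x m1 (inverse w1))) \<and>
            (\<forall>x. coherent_prior_density K pl x = f_N x m1 (inverse w1))))"
proof -
  have sum_pos_K: "(\<Sum>i=1..K. u i) > 0" if "\<forall>i\<in>{1..K}. u i > 0" for u :: "nat \<Rightarrow> real"
    using assms that by (intro sum_pos) auto
  have precision: "coherent_prior_density K (joint_prior_density K (\<lambda>i x. f_N x (m i) (inverse (u i))))
      = (\<lambda>x. f_N x ((\<Sum>i=1..K. u i * m i) / (\<Sum>i=1..K. u i)) (inverse (\<Sum>i=1..K. u i)))"
    if "\<forall>i\<in>{1..K}. u i > 0" for u
    using coherent_prior_density_normal_precision[OF assms] that by blast
  have variance: "coherent_prior_density K (joint_prior_density K (\<lambda>i x. f_N x (m i) (v i)))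
      = (\<lambda>x. f_N x ((\<Sum>i=1..K. m i / v i) / (\<Sum>i=1..K. 1 / v i)) (inverse (\<Sum>i=1..K. 1 / v i)))"
    if "\<forall>i\<in>{1..K}. v i > 0"
    using precision[of "\<lambda>i. 1 / v i"] that by (simp add: inverse_eq_divide)
  show ?thesis
    using sum_pos_K[of w] sum_pos_K[of "\<lambda>i. 1 / v i"] precision[of w] variance
    by (simp add: Let_def coherent_prior_def)
qed

end
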